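(* Let $1<p\le\infty$, let $\{\mathbb{X}_n\}_{n\in\mathbb{N}}$ be a sequence of nonzero real Banach spaces, and let $\mathcal{X}=\left(\sum_{n=1}^{\infty}\oplus\mathbb{X}_n\right)_p$. Then $\mathcal{X}$ has the BCP if and only if each $\mathbb{X}_n$ has the BCP. Moreover, in that case the ball covering centers for $\mathcal{X}$ can be chosen among elements of $\mathcal{X}$ having exactly one nonzero coordinate.
   Context: For $1<p<\infty$, $\left(\sum_{n}\oplus\mathbb{X}_n\right)_p$ is the space of sequences $\widetilde{x}=(x_1,x_2,\dots)$ with $x_i\in\mathbb{X}_i$ and $\|\widetilde{x}\|=(\sum_i\|x_i\|^p)^{1/p}<\infty$; for $p=\infty$, it is the space of such sequences with $\|\widetilde{x}\|=\sup_i\|x_i\|<\infty$. A normed space $\mathbb{Z}$ has the Ball Covering Property (BCP) if there are $z_n\in\mathbb{Z}\setminus\{0\}$ and $0<r_n\le\|z_n\|$ ($n\in\mathbb{N}$) such that the unit sphere of $\mathbb{Z}$ is contained in $\bigcup_n B(z_n,r_n)$, where $B(z,r)$ is the open ball of center $z$ and radius $r$. The points $z_n$ are the ball covering centers. *)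

theory Defs
  imports "HOL-Analysis.Analysis" "HOL-Library.Function_Algebras"
begin

text \<open>
  A sequence of Banach spaces needs spaces that vary with the index, which the type class
  \<^class>\<open>banach\<close> cannot provide. A real normed space is therefore a pair \<open>(V, N)\<close>: a linear subspace
  \<open>V\<close> of an ambient real vector space, which carries no norm or topology, and a norm \<open>N\<close> on \<open>V\<close>,
  whose values outside \<open>V\<close> are irrelevant. A common ambient vector space is no loss of
  generality: every sequence of real vector spaces embeds in its direct product, and the norms
  on different subspaces are unrelated.
\<close>

definition norm_on :: "'a::real_vector set \<Rightarrow> ('a \<Rightarrow> real) \<Rightarrow> bool" where
  "norm_on V N \<longleftrightarrow> subspace V \<and>
     (\<forall>x\<in>V. 0 \<le> N x \<and> (N x = 0 \<longleftrightarrow> x = 0)) \<and>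
     (\<forall>a. \<forall>x\<in>V. N (a *\<^sub>R x) = \<bar>a\<bar> * N x) \<and>
     (\<forall>x\<in>V. \<forall>y\<in>V. N (x + y) \<le> N x + N y)"

definition banach_on :: "'a::real_vector set \<Rightarrow> ('a \<Rightarrow> real) \<Rightarrow> bool" where
  "banach_on V N \<longleftrightarrow> norm_on V N \<and>
     Metric_space.mcomplete V (\<lambda>x y. if x \<in> V \<and> y \<in> V then N (x - y) else 0)"

text \<open>
  The distance is set to \<open>0\<close> off \<open>V\<close> because the library requires a metric to be
  nonnegative and symmetric on the whole type.
\<close>

lemma norm_on_Metric_space:
  assumes "norm_on V N"
  shows "Metric_space V (\<lambda>x y. if x \<in> V \<and> y \<in> V then N (x - y) else 0)"
proof
  have sub: "subspace V" and nn: "\<And>x. x \<in> V \<Longrightarrow> 0 \<le> N x"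
    and z: "\<And>x. x \<in> V \<Longrightarrow> N x = 0 \<longleftrightarrow> x = 0"
    and sc: "\<And>a x. x \<in> V \<Longrightarrow> N (a *\<^sub>R x) = \<bar>a\<bar> * N x"
    and tri: "\<And>x y. x \<in> V \<Longrightarrow> y \<in> V \<Longrightarrow> N (x + y) \<le> N x + N y"
    using assms unfolding norm_on_def by auto
  note diff = subspace_diff[OF sub]
  show "0 \<le> (if x \<in> V \<and> y \<in> V then N (x - y) else 0)" for x y
    using nn diff by simp
  show "(if x \<in> V \<and> y \<in> V then N (x - y) else 0) = (if y \<in> V \<and> x \<in> V then N (y - x) else 0)"
    for x y
    using sc[of "x - y" "-1"] diff by auto
  show "(if x \<in> V \<and> y \<in> V then N (x - y) else 0) = 0 \<longleftrightarrow> x = y" if "x \<in> V" "y \<in> V" for x y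
    using that z[of "x - y"] diff by simp
  show "(if x \<in> V \<and> w \<in> V then N (x - w) else 0)
      \<le> (if x \<in> V \<and> y \<in> V then N (x - y) else 0) + (if y \<in> V \<and> w \<in> V then N (y - w) else 0)"
    if "x \<in> V" "y \<in> V" "w \<in> V" for x y w
    using that tri[of "x - y" "y - w"] diff by simp
qed

text \<open>
  The covering notions only use differences, so \<open>V\<close> may be a set of sequences, with the pointwise
  operations on functions.
\<close>

definition ball_covering ::
    "'a::ab_group_add set \<Rightarrow> ('a \<Rightarrow> real) \<Rightarrow> (nat \<Rightarrow> 'a) \<Rightarrow> (nat \<Rightarrow> real) \<Rightarrow> bool" where
  "ball_covering V N z r \<longleftrightarrow>
     (\<forall>n. z n \<in> V - {0} \<and> 0 < r n \<and> r n \<le> N (z n)) \<and>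
     {x \<in> V. N x = 1} \<subseteq> (\<Union>n. {x \<in> V. N (x - z n) < r n})"

definition BCP :: "'a::ab_group_add set \<Rightarrow> ('a \<Rightarrow> real) \<Rightarrow> bool" where
  "BCP V N \<longleftrightarrow> (\<exists>z r. ball_covering V N z r)"

definition lp_sum ::
    "ereal \<Rightarrow> (nat \<Rightarrow> 'a set) \<Rightarrow> (nat \<Rightarrow> 'a \<Rightarrow> real) \<Rightarrow> (nat \<Rightarrow> 'a) set" where
  "lp_sum p X N = {x. (\<forall>i. x i \<in> X i) \<and>
     (if p = \<infinity> then bdd_above (range (\<lambda>i. N i (x i)))
      else summable (\<lambda>i. N i (x i) powr real_of_ereal p))}"

definition lp_norm :: "ereal \<Rightarrow> (nat \<Rightarrow> 'a \<Rightarrow> real) \<Rightarrow> (nat \<Rightarrow> 'a) \<Rightarrow> real" where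
  "lp_norm p N x =
     (if p = \<infinity> then (SUP i. N i (x i))
      else (\<Sum>i. N i (x i) powr real_of_ereal p) powr (1 / real_of_ereal p))"

end

theory Submission
  imports Defs "HOL-Real_Asymp.Real_Asymp"
begin

text \<open>
  Enlarging a radius to the norm of its center keeps a ball covering a ball covering, so the BCP
  asks for a countable set \<open>C\<close> of nonzero vectors such that every unit vector \<open>x\<close> is closer to some
  \<open>z \<in> C\<close> than \<open>0\<close> is: \<open>N (x - z) < N z\<close>. Both directions are about this strict inequality.

  From the sum to the summands: view a unit vector \<open>x\<close> of \<open>X n\<close> as a sequence supported at \<open>n\<close>. If
  a center \<open>z\<close> of the sum is strictly closer to \<open>x\<close> than to \<open>0\<close>, its coordinate \<open>z n\<close> must be
  strictly closer to \<open>x\<close> than to \<open>0\<close>, because \<open>z\<close> and \<open>z - x\<close> agree elsewhere and the norm of the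
  sum is monotone in the norms of the coordinates. So the \<open>n\<close>-th coordinates of the centers work.

  From the summands to the sum: the centers are the positive integer multiples \<open>m *\<^sub>R z\<close> of the
  centers \<open>z\<close> of \<open>X n\<close>, placed at coordinate \<open>n\<close>. Let \<open>x\<close> be a unit vector of the sum and pick \<open>n\<close>
  with \<open>x n \<noteq> 0\<close>. Some center \<open>z\<close> of \<open>X n\<close> is strictly closer to the normalized \<open>x n\<close> than to \<open>0\<close>,
  and by the triangle inequality this gain survives multiplication of the center: there is
  \<open>d > 0\<close> with \<open>N n (x n - m *\<^sub>R z) \<le> m * N n z - d\<close> for all large \<open>m\<close>. The other coordinates of \<open>x\<close>
  have norm at most \<open>1\<close>, and they cannot destroy the gain: with \<open>T = m * N n z\<close> one has
  \<open>max (T - d) 1 < T\<close> for large \<open>T\<close>, and for finite \<open>p\<close> also \<open>(T - d) powr p + 1 < T powr p\<close>, since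
  \<open>T powr p - (T - d) powr p\<close> tends to infinity. The last point is where \<open>p > 1\<close> enters.
\<close>

section \<open>Ball coverings with maximal radii\<close>

lemma norm_onD:
  assumes "norm_on V N"
  shows "subspace V" "x \<in> V \<Longrightarrow> 0 \<le> N x" "x \<in> V \<Longrightarrow> N x = 0 \<longleftrightarrow> x = 0"
    "x \<in> V \<Longrightarrow> N (a *\<^sub>R x) = \<bar>a\<bar> * N x"
    "x \<in> V \<Longrightarrow> y \<in> V \<Longrightarrow> N (x + y) \<le> N x + N y"
  using assms unfolding norm_on_def by auto

lemma norm_on_uminus:
  assumes "norm_on V N" "x \<in> V"
  shows "N (- x) = N x"
  using norm_onD(4)[OF assms, of "-1"] by simp

lemma ball_covering_closer_center:
  assumes "ball_covering V N z r" "x \<in> V" "N x = 1"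
  shows "\<exists>k. N (x - z k) < N (z k)"
proof -
  obtain k where "N (x - z k) < r k"
    using assms unfolding ball_covering_def by blast
  moreover have "r k \<le> N (z k)"
    using assms(1) unfolding ball_covering_def by blast
  ultimately show ?thesis by (intro exI[of _ k]) linarith
qed

lemma ball_covering_of_countable:
  assumes "countable C" "C \<noteq> {}" "C \<subseteq> V - {0}" "\<And>z. z \<in> C \<Longrightarrow> 0 < N z"
    and cover: "\<And>x. x \<in> V \<Longrightarrow> N x = 1 \<Longrightarrow> \<exists>z\<in>C. N (x - z) < N z"
  shows "\<exists>z r. ball_covering V N z r \<and> range z = C"
proof -
  have rng: "range (from_nat_into C) = C"
    using assms(1,2) by (rule range_from_nat_into[rotated])
  have mem: "from_nat_into C k \<in> C" for k
    using assms(2) by (rule from_nat_into)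
  have "ball_covering V N (from_nat_into C) (\<lambda>k. N (from_nat_into C k))"
    unfolding ball_covering_def
  proof (intro conjI allI subsetI)
    fix x assume "x \<in> {x \<in> V. N x = 1}"
    then obtain z where "z \<in> C" "N (x - z) < N z" "x \<in> V" using cover by blast
    moreover obtain k where "z = from_nat_into C k" using rng \<open>z \<in> C\<close> by blast
    ultimately show "x \<in> (\<Union>k. {x \<in> V. N (x - from_nat_into C k) < N (from_nat_into C k)})"
      by blast
  qed (use mem assms(3,4) in auto)
  with rng show ?thesis by blast
qed

text \<open>
  The gain \<open>d\<close> of \<open>N (x - t *\<^sub>R z)\<close> over \<open>N (t *\<^sub>R z)\<close> can be chosen before \<open>t\<close>, because
  adding further multiples of \<open>z\<close> to the center costs no more than it adds to its norm.
\<close>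

lemma closer_to_multiples_of_center:
  assumes norm: "norm_on V N" and V: "x \<in> V" "z \<in> V" and "x \<noteq> 0"
    and closer: "N ((1 / N x) *\<^sub>R x - z) < N z"
  shows "\<exists>d>0. \<forall>t\<ge>N x. N (x - t *\<^sub>R z) \<le> t * N z - d"
proof (intro exI conjI allI impI)
  let ?a = "N x" and ?w = "(1 / N x) *\<^sub>R x - z"
  note sub = norm_onD(1)[OF norm]
  have a: "0 < ?a" using norm_onD(2,3)[OF norm V(1)] \<open>x \<noteq> 0\<close> by simp
  have w: "?w \<in> V" using V by (intro subspace_diff subspace_scale sub)
  show "0 < ?a * (N z - N ?w)" using a closer by simp
  fix t assume t: "?a \<le> t"
  have "x - t *\<^sub>R z = ?a *\<^sub>R ?w + (?a - t) *\<^sub>R z"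
    using a by (simp add: algebra_simps)
  also have "N \<dots> \<le> N (?a *\<^sub>R ?w) + N ((?a - t) *\<^sub>R z)"
    using w V by (intro norm_onD(5)[OF norm] subspace_scale sub)
  also have "\<dots> = ?a * N ?w + (t - ?a) * N z"
    using norm_onD(4)[OF norm] w V a t by simp
  finally show "N (x - t *\<^sub>R z) \<le> t * N z - ?a * (N z - N ?w)"
    by (simp add: algebra_simps)
qed

section \<open>The norm of a direct sum\<close>

lemma exponent_cases:
  fixes p :: ereal
  assumes "1 < p"
  obtains (infinite) "p = \<infinity>" | (finite) q where "p = ereal q" "1 < q"
  using assms by (cases p) auto

lemma fun_upd_eq_add_single:
  fixes f :: "nat \<Rightarrow> real"
  shows "f(n := v) = (\<lambda>i. f i + (if i = n then v - f n else 0))"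
  by auto

lemma summable_fun_upd:
  fixes f :: "nat \<Rightarrow> real"
  assumes "summable f"
  shows "summable (f(n := v))"
  unfolding fun_upd_eq_add_single
  by (intro summable_add assms sums_summable[OF sums_single])

lemma suminf_fun_upd:
  fixes f :: "nat \<Rightarrow> real"
  assumes "summable f"
  shows "suminf (f(n := v)) = suminf f + (v - f n)"
  unfolding fun_upd_eq_add_single
  using sums_add[OF summable_sums[OF assms] sums_single[of n "\<lambda>_. v - f n"]]
  by (simp add: sums_iff)

lemma norms_fun_upd:
  "(\<lambda>i. N i ((x(n := u)) i)) = (\<lambda>i. N i (x i))(n := N n u)"
  "(\<lambda>i. N i ((x(n := u)) i) powr q) = (\<lambda>i. N i (x i) powr q)(n := N n u powr q)"
  by auto

lemma bdd_above_range_fun_upd: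
  fixes f :: "nat \<Rightarrow> real"
  assumes "bdd_above (range f)"
  shows "bdd_above (range (f(n := v)))"
proof (rule bdd_above_mono)
  show "bdd_above (insert v (range f))" using assms by simp
qed auto

lemma lp_sum_fun_upd:
  assumes "x \<in> lp_sum p X N" "u \<in> X n"
  shows "x(n := u) \<in> lp_sum p X N"
proof -
  have "(x(n := u)) i \<in> X i" for i using assms by (simp add: lp_sum_def)
  moreover have "bdd_above (range (\<lambda>i. N i ((x(n := u)) i)))" if "p = \<infinity>"
    unfolding norms_fun_upd[of N x]
    by (rule bdd_above_range_fun_upd) (use assms that in \<open>simp add: lp_sum_def\<close>)
  moreover have "summable (\<lambda>i. N i ((x(n := u)) i) powr real_of_ereal p)" if "p \<noteq> \<infinity>"
    unfolding norms_fun_upd[of N x]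
    by (rule summable_fun_upd) (use assms that in \<open>simp add: lp_sum_def\<close>)
  ultimately show ?thesis unfolding lp_sum_def by simp
qed

lemma zero_in_lp_sum:
  assumes "\<And>n. norm_on (X n) (N n)"
  shows "0 \<in> lp_sum p X N"
proof -
  have "0 \<in> X i" for i using subspace_0[OF norm_onD(1)[OF assms]] .
  moreover from this have "N i 0 = 0" for i using norm_onD(3)[OF assms] by blast
  ultimately show ?thesis by (simp add: lp_sum_def)
qed

lemma lp_norm_mono:
  assumes "1 < p" and y: "y \<in> lp_sum p Y M"
    and le: "\<And>i. 0 \<le> N i (x i)" "\<And>i. N i (x i) \<le> M i (y i)"
  shows "lp_norm p N x \<le> lp_norm p M y"
  using assms(1)
proof (cases rule: exponent_cases)
  case infinite
  with y have "bdd_above (range (\<lambda>i. M i (y i)))" by (simp add: lp_sum_def)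
  with le show ?thesis using infinite by (auto simp: lp_norm_def intro!: cSUP_mono)
next
  case (finite q)
  with y have sum: "summable (\<lambda>i. M i (y i) powr q)" by (simp add: lp_sum_def)
  have powr_le: "N i (x i) powr q \<le> M i (y i) powr q" for i
    using le finite by (intro powr_mono2) auto
  have "summable (\<lambda>i. N i (x i) powr q)"
    by (rule summable_comparison_test[OF _ sum]) (use powr_le in auto)
  then show ?thesis using finite sum powr_le le
    by (auto simp: lp_norm_def intro!: powr_mono2 suminf_le suminf_nonneg)
qed

lemma lp_norm_single:
  assumes norm: "\<And>n. norm_on (X n) (N n)" and "1 < p" "u \<in> X n"
  shows "lp_norm p N (0(n := u)) = N n u"
proof -
  have zero: "N i 0 = 0" for i
    using norm_onD(3)[OF norm] subspace_0[OF norm_onD(1)[OF norm]] by blast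
  have u: "0 \<le> N n u" using norm_onD(2)[OF norm] assms(3) .
  from \<open>1 < p\<close> show ?thesis
  proof (cases rule: exponent_cases)
    case infinite
    have "(SUP i. N i ((0(n := u)) i)) = N n u"
      by (rule cSup_eq_maximum) (use zero u in \<open>auto simp: image_iff intro: exI[of _ n]\<close>)
    with infinite show ?thesis by (simp add: lp_norm_def)
  next
    case (finite q)
    have "(\<Sum>i. N i ((0(n := u)) i) powr q) = N n u powr q"
      unfolding norms_fun_upd(2)[of N 0] by (subst suminf_fun_upd) (auto simp: zero)
    with finite u show ?thesis by (simp add: lp_norm_def powr_powr)
  qed
qed

text \<open>
  A gain of \<open>d\<close> in one coordinate outweighs all the others, provided that coordinate is large: for
  \<open>p = \<infinity>\<close> the others are bounded, and for finite \<open>p\<close> they add a fixed amount to the sum of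
  \<open>p\<close>-th powers, which falls below \<open>T powr p - (T - d) powr p\<close>.
\<close>

lemma eventually_lp_norm_fun_upd_less:
  assumes norm: "\<And>n. norm_on (X n) (N n)" and p: "1 < p"
    and x: "x \<in> lp_sum p X N" and d: "0 < d"
  shows "\<forall>\<^sub>F T in at_top. \<forall>u\<in>X n. N n u \<le> T - d \<longrightarrow> lp_norm p N (x(n := u)) < T"
proof -
  show ?thesis
    using p
  proof (cases rule: exponent_cases)
    case infinite
    with x have "bdd_above (range (\<lambda>i. N i (x i)))" by (simp add: lp_sum_def)
    then obtain B where B: "\<And>i. N i (x i) \<le> B" by (auto simp: bdd_above_def)
    have "lp_norm p N (x(n := u)) < T" if "B + d \<le> T" "N n u \<le> T - d" for T u
    proof -
      have "N i ((x(n := u)) i) \<le> T - d" for i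
        using that B[of i] by auto
      then have "(SUP i. N i ((x(n := u)) i)) \<le> T - d"
        by (intro cSUP_least) auto
      with d infinite show ?thesis by (simp add: lp_norm_def)
    qed
    then show ?thesis
      by (intro eventually_mono[OF eventually_ge_at_top[of "B + d"]]) blast
  next
    case (finite q)
    let ?S = "\<Sum>i. N i (x i) powr q"
    have sum: "summable (\<lambda>i. N i (x i) powr q)" using x finite by (simp add: lp_sum_def)
    have "filterlim (\<lambda>T. T powr q - (T - d) powr q) at_top at_top"
      using finite(2) d by real_asymp
    then have "\<forall>\<^sub>F T in at_top. ?S < T powr q - (T - d) powr q"
      by (simp add: filterlim_at_top_dense)
    then show ?thesis
      using eventually_gt_at_top[of 0]
    proof eventually_elim
      case (elim T)
      show ?case
      proof (intro ballI impI)
        fix u assume u: "u \<in> X n" "N n u \<le> T - d"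
        let ?f = "(\<lambda>i. N i (x i) powr q)(n := N n u powr q)"
        have "suminf ?f \<le> ?S + N n u powr q"
          using suminf_fun_upd[OF sum, of n] by simp
        also have "\<dots> \<le> ?S + (T - d) powr q"
          using u norm_onD(2)[OF norm] finite by (intro add_mono powr_mono2) auto
        also have "\<dots> < T powr q" using elim by simp
        finally have "suminf ?f < T powr q" .
        moreover have "0 \<le> suminf ?f"
          by (intro suminf_nonneg summable_fun_upd sum) simp
        ultimately have "suminf ?f powr (1 / q) < (T powr q) powr (1 / q)"
          using finite by (intro powr_less_mono2) auto
        also have "\<dots> = T" using finite elim by (simp add: powr_powr)
        finally show "lp_norm p N (x(n := u)) < T"
          using finite by (simp add: lp_norm_def norms_fun_upd(2)[of N x] del: fun_upd_apply)
      qed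
    qed
  qed
qed

section \<open>Ball coverings of a direct sum and of its summands\<close>

text \<open>
  Contrapositively: if no coordinate of \<open>z\<close> shrinks when \<open>u\<close> is subtracted from \<open>z\<close> at \<open>n\<close>, the
  norm of \<open>z\<close> does not shrink either.
\<close>

lemma closer_in_coordinate:
  assumes norm: "\<And>n. norm_on (X n) (N n)" and p: "1 < p"
    and z: "z \<in> lp_sum p X N" and u: "u \<in> X n"
    and closer: "lp_norm p N (0(n := u) - z) < lp_norm p N z"
  shows "N n (u - z n) < N n (z n)"
proof (rule ccontr)
  assume not_closer: "\<not> ?thesis"
  let ?w = "z(n := u - z n)"
  have zi: "z i \<in> X i" for i using z by (simp add: lp_sum_def)
  have "u - z n \<in> X n" using subspace_diff[OF norm_onD(1)[OF norm]] u zi .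
  then have w: "?w \<in> lp_sum p X N" using z by (rule lp_sum_fun_upd[rotated])
  have "N i ((0(n := u) - z) i) = N i (?w i)" for i
    using norm_on_uminus[OF norm zi] by simp
  then have "lp_norm p N (0(n := u) - z) = lp_norm p N ?w"
    unfolding lp_norm_def by presburger
  moreover have "lp_norm p N z \<le> lp_norm p N ?w"
    using p w by (rule lp_norm_mono) (use not_closer norm_onD(2)[OF norm zi] in auto)
  ultimately show False using closer by simp
qed

lemma unit_vector_exists:
  assumes "norm_on V N" "V \<noteq> {0}"
  obtains x where "x \<in> V" "N x = 1"
proof -
  note sub = norm_onD(1)[OF assms(1)]
  obtain v where v: "v \<in> V" "v \<noteq> 0" using assms(2) subspace_0[OF sub] by auto
  then have "0 < N v" using norm_onD(2,3)[OF assms(1) v(1)] by simp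
  then have "N ((1 / N v) *\<^sub>R v) = 1" using norm_onD(4)[OF assms(1) v(1)] by simp
  then show ?thesis using that subspace_scale[OF sub v(1)] by blast
qed

lemma BCP_summand:
  assumes norm: "\<And>n. norm_on (X n) (N n)" and p: "1 < p" and nontrivial: "X n \<noteq> {0}"
    and "BCP (lp_sum p X N) (lp_norm p N)"
  shows "BCP (X n) (N n)"
proof -
  obtain z r where cov: "ball_covering (lp_sum p X N) (lp_norm p N) z r"
    using assms(4) unfolding BCP_def by blast
  have z: "z k \<in> lp_sum p X N" for k using cov unfolding ball_covering_def by blast
  then have zn: "z k n \<in> X n" for k unfolding lp_sum_def by blast
  let ?C = "range (\<lambda>k. z k n) - {0}"
  have closer: "\<exists>c\<in>?C. N n (u - c) < N n c" if u: "u \<in> X n" "N n u = 1" for u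
  proof -
    have "0(n := u) \<in> lp_sum p X N"
      using zero_in_lp_sum[where X = X and N = N, OF norm] u(1) by (rule lp_sum_fun_upd)
    moreover have "lp_norm p N (0(n := u)) = 1"
      using lp_norm_single[where X = X and N = N, OF norm p u(1)] u(2) by simp
    ultimately obtain k where "lp_norm p N (0(n := u) - z k) < lp_norm p N (z k)"
      using ball_covering_closer_center[OF cov] by blast
    then have less: "N n (u - z k n) < N n (z k n)"
      using closer_in_coordinate[where X = X and N = N, OF norm p z u(1)] by blast
    have "0 \<le> N n (u - z k n)"
      using norm_onD(2)[OF norm] subspace_diff[OF norm_onD(1)[OF norm] u(1) zn] by blast
    with less have "z k n \<noteq> 0" using norm_onD(3)[OF norm zn] by (metis not_le)
    with less show ?thesis by blast
  qed
  have "\<exists>z r. ball_covering (X n) (N n) z r \<and> range z = ?C"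
  proof (rule ball_covering_of_countable)
    obtain u where "u \<in> X n" "N n u = 1"
      using unit_vector_exists[OF norm nontrivial] .
    from closer[OF this] show "?C \<noteq> {}" by blast
    show "0 < N n c" if "c \<in> ?C" for c
    proof -
      have "c \<in> X n" "c \<noteq> 0" using that zn by auto
      then show ?thesis using norm_onD(2,3)[OF norm[of n], of c] by simp
    qed
  qed (use closer zn in auto)
  then show ?thesis unfolding BCP_def by blast
qed

lemma single_coordinate_ball_covering:
  assumes norm: "\<And>n. norm_on (X n) (N n)" and p: "1 < p" and nontrivial: "X n\<^sub>0 \<noteq> {0}"
    and "\<And>n. BCP (X n) (N n)"
  shows "\<exists>z r. ball_covering (lp_sum p X N) (lp_norm p N) z r \<and> (\<forall>k. \<exists>!i. z k i \<noteq> 0)"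
proof -
  obtain c s where cov: "\<And>n. ball_covering (X n) (N n) (c n) (s n)"
    using assms(4) unfolding BCP_def by metis
  have c: "c n k \<in> X n" and c0: "c n k \<noteq> 0" for n k
    using cov unfolding ball_covering_def by blast+
  note sub = norm_onD(1)[OF norm]
  \<comment> \<open>\<open>Suc m\<close> rather than \<open>m\<close>, because centers must not vanish.\<close>
  define e where "e = (\<lambda>(n, m, k). (0 :: nat \<Rightarrow> 'a)(n := real (Suc m) *\<^sub>R c n k))"
  have scaled: "real (Suc m) *\<^sub>R c n k \<in> X n" "real (Suc m) *\<^sub>R c n k \<noteq> 0" for n m k
    using subspace_scale[OF sub c] c0 by auto
  have norm_e: "lp_norm p N (e (n, m, k)) = real (Suc m) * N n (c n k)" for n m k
    using lp_norm_single[where X = X and N = N, OF norm p scaled(1)] norm_onD(4)[OF norm c]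
    by (simp add: e_def)
  have norm_c: "0 < N n (c n k)" for n k
    using norm_onD(2,3)[OF norm c] c0 by (metis less_eq_real_def)
  have "\<exists>z r. ball_covering (lp_sum p X N) (lp_norm p N) z r \<and> range z = range e"
  proof (rule ball_covering_of_countable)
    show "range e \<subseteq> lp_sum p X N - {0}"
    proof clarify
      fix n m k
      have "e (n, m, k) n \<noteq> 0" using scaled(2) by (simp add: e_def)
      moreover have "e (n, m, k) \<in> lp_sum p X N"
        unfolding e_def prod.case
        using zero_in_lp_sum[where X = X and N = N, OF norm] scaled(1) by (rule lp_sum_fun_upd)
      ultimately show "e (n, m, k) \<in> lp_sum p X N - {0}" by auto
    qed
    show "0 < lp_norm p N z" if "z \<in> range e" for z
      using that norm_e norm_c by auto
  next
    fix x assume x: "x \<in> lp_sum p X N" and x1: "lp_norm p N x = 1"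
    have xi: "x i \<in> X i" for i using x by (simp add: lp_sum_def)
    have "x \<noteq> 0"
    proof
      assume "x = 0"
      then have "x = 0(n\<^sub>0 := 0)" by (simp add: fun_eq_iff)
      then have "lp_norm p N x = N n\<^sub>0 0"
        using lp_norm_single[where X = X and N = N, OF norm p subspace_0[OF sub]] by metis
      also have "\<dots> = 0" using norm_onD(3)[OF norm subspace_0[OF sub]] by simp
      finally show False using x1 by simp
    qed
    then obtain n where n: "x n \<noteq> 0" by (auto simp: fun_eq_iff)
    then have xn: "0 < N n (x n)" using norm_onD(2,3)[OF norm xi] by (metis less_eq_real_def)
    let ?u = "(1 / N n (x n)) *\<^sub>R x n"
    have "?u \<in> X n" "N n ?u = 1"
      using subspace_scale[OF sub xi] norm_onD(4)[OF norm xi] xn by auto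
    then obtain k where "N n (?u - c n k) < N n (c n k)"
      using ball_covering_closer_center[OF cov] by blast
    then obtain d where d: "0 < d"
      "\<And>t. N n (x n) \<le> t \<Longrightarrow> N n (x n - t *\<^sub>R c n k) \<le> t * N n (c n k) - d"
      using closer_to_multiples_of_center[OF norm xi c n] by blast
    have lim: "filterlim (\<lambda>m. real (Suc m) * N n (c n k)) at_top sequentially"
      "filterlim (\<lambda>m. real (Suc m)) at_top sequentially"
      using norm_c[of n k] by real_asymp+
    have "\<forall>\<^sub>F m in sequentially. N n (x n) \<le> real (Suc m) \<and>
        (\<forall>u\<in>X n. N n u \<le> real (Suc m) * N n (c n k) - d \<longrightarrow>
          lp_norm p N (x(n := u)) < real (Suc m) * N n (c n k))"
      using lim(2)[unfolded filterlim_at_top, rule_format, of "N n (x n)"]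
        eventually_compose_filterlim[OF eventually_lp_norm_fun_upd_less[where X = X and N = N, OF norm p x d(1)] lim(1)]
      by (rule eventually_conj)
    then obtain m where m: "N n (x n) \<le> real (Suc m)"
      "\<And>u. u \<in> X n \<Longrightarrow> N n u \<le> real (Suc m) * N n (c n k) - d \<Longrightarrow>
        lp_norm p N (x(n := u)) < real (Suc m) * N n (c n k)"
      using eventually_happens by force
    have "x - e (n, m, k) = x(n := x n - real (Suc m) *\<^sub>R c n k)"
      by (simp add: e_def fun_eq_iff)
    moreover have "x n - real (Suc m) *\<^sub>R c n k \<in> X n"
      using xi scaled(1) by (rule subspace_diff[OF sub])
    ultimately have "lp_norm p N (x - e (n, m, k)) < lp_norm p N (e (n, m, k))"
      using m(2) d(2)[OF m(1)] norm_e by simp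
    then show "\<exists>z\<in>range e. lp_norm p N (x - z) < lp_norm p N z" by blast
  qed auto
  then obtain z r where z: "ball_covering (lp_sum p X N) (lp_norm p N) z r" "range z = range e"
    by blast
  have "\<exists>!i. z j i \<noteq> 0" for j
  proof -
    obtain n m k where "z j = e (n, m, k)" using z(2) by (metis rangeI imageE prod_cases3)
    then show ?thesis using scaled(2)[where n = n and m = m and k = k] by (auto simp: e_def)
  qed
  with z(1) show ?thesis by blast
qed

theorem theorem3p19:
  fixes p :: ereal
    and X :: "nat \<Rightarrow> 'a::real_vector set"
    and N :: "nat \<Rightarrow> 'a \<Rightarrow> real"
  assumes "1 < p"
    and "\<And>n. banach_on (X n) (N n)"
    and "\<And>n. X n \<noteq> {0}"
  shows "(BCP (lp_sum p X N) (lp_norm p N) \<longleftrightarrow> (\<forall>n. BCP (X n) (N n))) \<and>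
    (BCP (lp_sum p X N) (lp_norm p N) \<longrightarrow>
      (\<exists>z r. ball_covering (lp_sum p X N) (lp_norm p N) z r \<and> (\<forall>k. \<exists>!i. z k i \<noteq> 0)))"
proof -
  have norm: "norm_on (X n) (N n)" for n using assms(2) unfolding banach_on_def by blast
  have summands: "BCP (X n) (N n)" if "BCP (lp_sum p X N) (lp_norm p N)" for n
    using norm assms(1) assms(3) that by (rule BCP_summand)
  have "\<exists>z r. ball_covering (lp_sum p X N) (lp_norm p N) z r \<and> (\<forall>k. \<exists>!i. z k i \<noteq> 0)"
    if "\<forall>n. BCP (X n) (N n)"
    using norm assms(1) assms(3) that[rule_format] by (rule single_coordinate_ball_covering)
  with summands show ?thesis unfolding BCP_def by blast
qed

end
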